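(* Let $R$ be a unique factorization domain, and let $\mathfrak{a}=(a)$ for some $a\in R$ such that $R/\mathfrak{a}$ is a finite ring. Then $$I_r(R/\mathfrak{a})\geq \mathsf{D}((R/\mathfrak{a})^\times)+\Omega(a)-\omega(a).$$ Moreover, equality holds whenever $a$ is a prime power. If $R$ is a principal ideal domain, then equality also holds whenever $a$ is a product of distinct primes, i.e., $a$ is not divisible by the square of any prime.
   Context: For a finite commutative ring $T$, $I_r(T)$ is the smallest positive integer $t$ such that every sequence of $t$ (not necessarily distinct) elements of $T$ contains a nonempty subsequence whose elements multiply to an idempotent element of $T$ (an element $x$ with $x^2=x$). For a finite abelian group $G$, $\mathsf{D}(G)$ (Davenport constant) is the smallest positive integer $t$ such that every sequence of $t$ elements of $G$ contains a nonempty subsequence whose elements multiply to the identity; $(R/\mathfrak{a})^\times$ is the unit group of $R/\mathfrak{a}$. For an element $a$ of a UFD, $\Omega(a)$ is the total number of primes in the prime factorization of $a$ counted with multiplicity, and $\omega(a)$ is the number of distinct primes (up to multiplication by units) in this factorization. *)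

theory Defs
  imports "HOL-Algebra.Ring_Divisibility"
begin

text \<open>A sequence of length \<open>t\<close> is a function on the index set \<open>{..<t}\<close>; a nonempty subsequence is
  given by a nonempty set \<open>J\<close> of indices, so repeated entries are counted as often as they occur.\<close>

definition davenport_constant :: "('a, 'b) monoid_scheme \<Rightarrow> nat" where
  "davenport_constant G =
    (LEAST t. 0 < t \<and> (\<forall>s \<in> {..<t} \<rightarrow> carrier G.
       \<exists>J \<subseteq> {..<t}. J \<noteq> {} \<and> finprod G s J = \<one>\<^bsub>G\<^esub>))"

definition ring_idempotent :: "('a, 'b) ring_scheme \<Rightarrow> 'a \<Rightarrow> bool" where
  "ring_idempotent T x \<longleftrightarrow> x \<in> carrier T \<and> x [^]\<^bsub>T\<^esub> (2::nat) = x"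

definition idempotent_constant :: "('a, 'b) ring_scheme \<Rightarrow> nat" where
  "idempotent_constant T =
    (LEAST t. 0 < t \<and> (\<forall>s \<in> {..<t} \<rightarrow> carrier T.
       \<exists>J \<subseteq> {..<t}. J \<noteq> {} \<and> ring_idempotent T (finprod T s J)))"

text \<open>The library's \<^const>\<open>factorcount\<close> counts the factors, with multiplicity, in a factorization into
  irreducibles (equivalently, in a factorial domain, primes) up to a unit. The element \<open>\<zero>\<close> has no
  factorization, and we put \<open>\<Omega>(\<zero>) = \<omega>(\<zero>) = 0\<close>. If \<open>R/(\<zero>)\<close> is finite then \<open>R\<close> is a finite field, which has
  no primes at all.\<close>

definition big_Omega :: "('a, 'b) ring_scheme \<Rightarrow> 'a \<Rightarrow> nat" where
  "big_Omega R a = (if a = \<zero>\<^bsub>R\<^esub> then 0 else factorcount (mult_of R) a)"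

text \<open>Distinct primes up to units are distinct classes of associates among the factors.\<close>

definition small_omega :: "('a, 'b) ring_scheme \<Rightarrow> 'a \<Rightarrow> nat" where
  "small_omega R a = (if a = \<zero>\<^bsub>R\<^esub> then 0 else
    (THE c. \<forall>fs. set fs \<subseteq> carrier (mult_of R) \<and> wfactors (mult_of R) fs a \<longrightarrow>
       c = card (assocs (mult_of R) ` set fs)))"

lemma (in factorial_domain) small_omega_eq:
  assumes a: "a \<in> carrier R" "a \<noteq> \<zero>"
    and fs: "set fs \<subseteq> carrier (mult_of R)" "wfactors (mult_of R) fs a"
  shows "small_omega R a = card (assocs (mult_of R) ` set fs)"
proof -
  have "card (assocs (mult_of R) ` set gs) = card (assocs (mult_of R) ` set fs)"
    if gs: "set gs \<subseteq> carrier (mult_of R)" "wfactors (mult_of R) gs a" for gs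
  proof -
    have "essentially_equal (mult_of R) gs fs"
      by (rule wfactors_unique[OF gs(2) fs(2) _ gs(1) fs(1)]) (simp add: a)
    then have "fmset (mult_of R) gs = fmset (mult_of R) fs"
      by (rule mult_of.ee_fmset[OF _ gs(1) fs(1)])
    then have "set_mset (fmset (mult_of R) gs) = set_mset (fmset (mult_of R) fs)"
      by simp
    then show ?thesis by (simp add: fmset_def)
  qed
  then have "(THE c. \<forall>gs. set gs \<subseteq> carrier (mult_of R) \<and> wfactors (mult_of R) gs a \<longrightarrow>
       c = card (assocs (mult_of R) ` set gs)) = card (assocs (mult_of R) ` set fs)"
    using fs by (intro the_equality) metis+
  then show ?thesis
    by (simp only: small_omega_def a(2) if_False)
qed

text \<open>Like \<open>\<Omega>\<close> and \<open>\<omega>\<close>, being a prime power is understood up to units: it depends only on \<open>(a)\<close>.\<close>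

definition is_prime_power :: "('a, 'b) ring_scheme \<Rightarrow> 'a \<Rightarrow> bool" where
  "is_prime_power R a \<longleftrightarrow>
    (\<exists>p \<in> carrier R. ring_prime\<^bsub>R\<^esub> p \<and> (\<exists>n::nat. a \<sim>\<^bsub>R\<^esub> p [^]\<^bsub>R\<^esub> n))"

definition prime_squarefree :: "('a, 'b) ring_scheme \<Rightarrow> 'a \<Rightarrow> bool" where
  "prime_squarefree R a \<longleftrightarrow>
    (\<forall>p \<in> carrier R. ring_prime\<^bsub>R\<^esub> p \<longrightarrow> \<not> (p [^]\<^bsub>R\<^esub> (2::nat)) divides\<^bsub>R\<^esub> a)"

end

theory Submission
  imports Defs
begin

text \<open>Write \<open>T = R/(a)\<close> and \<open>D\<close> for the Davenport constant of its unit group.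

  Lower bound: write \<open>a\<close>, up to a unit, as the product of a list \<open>gs\<close> of \<open>\<Omega>(a) - \<omega>(a)\<close> primes and of
  the radical \<open>r\<close>, and append \<open>gs\<close> to a sequence of \<open>D - 1\<close> units of \<open>T\<close> without a subproduct \<open>1\<close>. A
  subproduct that uses some \<open>q\<close> in \<open>gs\<close> is \<open>z = u d\<close> with \<open>u\<close> a unit mod \<open>a\<close> and \<open>q\<close> dividing \<open>d\<close>, and
  \<open>a = d k\<close> where \<open>r\<close>, hence \<open>q\<close>, divides \<open>k\<close>. If \<open>z\<close> were idempotent, cancelling \<open>d\<close> would give
  that \<open>k\<close>, hence \<open>q\<close>, divides \<open>u (u d - 1)\<close>, so \<open>q\<close> would divide \<open>1\<close>.

  Upper bound for \<open>a = p^n\<close>: the nonunits of \<open>T\<close> are the multiples of \<open>p\<close>, so any \<open>n\<close> of them have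
  product \<open>0\<close>, and otherwise at least \<open>D\<close> entries are units. Upper bound for squarefree \<open>a\<close>: \<open>T\<close> is
  finite and reduced, so each element is an idempotent times a unit, and it suffices that the unit
  parts have a subproduct \<open>1\<close>.\<close>

subsection \<open>Subproducts in finite commutative monoids\<close>

text \<open>The target set \<open>E\<close> is a parameter so that both constants become the least
  \<open>t\<close> of one predicate: \<open>{\<one>}\<close> gives the Davenport constant, the set
  of idempotents gives \<open>idempotent_constant\<close>.\<close>

definition has_subproduct_in :: "('a, 'b) monoid_scheme \<Rightarrow> 'a set \<Rightarrow> nat \<Rightarrow> bool" where
  "has_subproduct_in G E t \<longleftrightarrow>
    (\<forall>s \<in> {..<t} \<rightarrow> carrier G. \<exists>J \<subseteq> {..<t}. J \<noteq> {} \<and> finprod G s J \<in> E)"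

text \<open>At \<open>t = 0\<close> there is no nonempty \<open>J\<close>, so the predicate absorbs
  the positivity clause of both constants.\<close>

lemma has_subproduct_in_pos:
  assumes "has_subproduct_in G E t"
  shows "0 < t"
  using assms by (cases t) (auto simp: has_subproduct_in_def)

lemma davenport_constant_eq: "davenport_constant G = (LEAST t. has_subproduct_in G {\<one>\<^bsub>G\<^esub>} t)"
proof -
  have "(0 < t \<and> (\<forall>s \<in> {..<t} \<rightarrow> carrier G. \<exists>J \<subseteq> {..<t}. J \<noteq> {} \<and> finprod G s J = \<one>\<^bsub>G\<^esub>))
      \<longleftrightarrow> has_subproduct_in G {\<one>\<^bsub>G\<^esub>} t" for t
    using has_subproduct_in_pos[of G "{\<one>\<^bsub>G\<^esub>}" t] by (auto simp: has_subproduct_in_def)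
  then show ?thesis by (simp add: davenport_constant_def)
qed

lemma idempotent_constant_eq:
  "idempotent_constant T = (LEAST t. has_subproduct_in T {x. ring_idempotent T x} t)"
proof -
  have "(0 < t \<and> (\<forall>s \<in> {..<t} \<rightarrow> carrier T. \<exists>J \<subseteq> {..<t}. J \<noteq> {} \<and> ring_idempotent T (finprod T s J)))
      \<longleftrightarrow> has_subproduct_in T {x. ring_idempotent T x} t" for t
    using has_subproduct_in_pos[of T "{x. ring_idempotent T x}" t] by (auto simp: has_subproduct_in_def)
  then show ?thesis by (simp add: idempotent_constant_def)
qed

text \<open>A bijection from \<open>{..<t}\<close> onto a \<open>t\<close>-element subset of
  \<open>A\<close> carries the sequence over. This allows arbitrary finite index sets later and
  yields monotonicity in \<open>t\<close>.\<close>

lemma (in comm_monoid) has_subproduct_in_finite_set: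
  assumes hits: "has_subproduct_in G E t" and A: "finite A" "t \<le> card A" "s \<in> A \<rightarrow> carrier G"
  shows "\<exists>J \<subseteq> A. J \<noteq> {} \<and> finprod G s J \<in> E"
proof -
  obtain B where B: "B \<subseteq> A" "card B = t" "finite B"
    using obtain_subset_with_card_n[OF A(2)] by metis
  obtain h where h: "bij_betw h {..<t} B"
    using ex_bij_betw_nat_finite[OF B(3)] by (auto simp: B(2) atLeast0LessThan)
  have "h ` {..<t} \<subseteq> A" using h B(1) by (simp add: bij_betw_def)
  then have "s \<circ> h \<in> {..<t} \<rightarrow> carrier G" using A(3) by fastforce
  then obtain J where J: "J \<subseteq> {..<t}" "J \<noteq> {}" "finprod G (s \<circ> h) J \<in> E"
    using hits unfolding has_subproduct_in_def by metis
  have sub: "h ` J \<subseteq> A" using J(1) h B(1) by (auto simp: bij_betw_def)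
  have "finprod G s (h ` J) = finprod G (\<lambda>i. s (h i)) J"
    using sub A(3) J(1) h by (intro finprod_reindex) (auto simp: bij_betw_def intro: inj_on_subset)
  then have "finprod G s (h ` J) \<in> E" using J(3) by (simp add: comp_def)
  moreover have "h ` J \<noteq> {}" using J(2) by simp
  ultimately show ?thesis using sub by blast
qed

text \<open>Two powers of \<open>x\<close> coincide, so the powers are periodic from some exponent
  \<open>i\<close> on, with a period \<open>p\<close>. If \<open>m\<close> is a positive multiple of
  \<open>p\<close> with \<open>i \<le> m\<close>, raising the exponent \<open>m\<close> by
  \<open>m\<close> changes nothing.\<close>

lemma (in monoid) finite_imp_idempotent_power:
  assumes "finite (carrier G)" and x: "x \<in> carrier G"
  shows "\<exists>m::nat. 0 < m \<and> x [^] m \<otimes> x [^] m = x [^] m"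
proof -
  have "\<not> inj (\<lambda>n::nat. x [^] n)"
  proof
    assume "inj (\<lambda>n::nat. x [^] n)"
    moreover have "range (\<lambda>n::nat. x [^] n) \<subseteq> carrier G" using x by auto
    ultimately show False
      using assms(1) finite_subset range_inj_infinite by blast
  qed
  then obtain i j :: nat where "i < j" "x [^] i = x [^] j"
    unfolding inj_def by (metis linorder_neqE_nat)
  then obtain p where p: "0 < p" "x [^] i = x [^] (i + p)"
    by (metis less_imp_add_positive)
  have period: "x [^] (n + p) = x [^] n" if "i \<le> n" for n
  proof -
    have "x [^] (n + p) = x [^] (i + p) \<otimes> x [^] (n - i)"
      using x that by (simp add: nat_pow_mult add.commute)
    also have "\<dots> = x [^] n"
      unfolding p(2)[symmetric] using x that by (simp add: nat_pow_mult)
    finally show ?thesis .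
  qed
  have periods: "x [^] (n + k * p) = x [^] n" if "i \<le> n" for n k
  proof (induction k)
    case (Suc k)
    then show ?case using period[of "n + k * p"] that by (simp add: ac_simps)
  qed simp
  \<comment> \<open>The factor \<open>Suc i\<close> instead of \<open>i\<close> keeps
    \<open>m\<close> positive when \<open>i = 0\<close>.\<close>
  define m where "m = Suc i * p"
  have "i \<le> m" using p(1) by (cases p) (auto simp: m_def)
  then have "x [^] (m + Suc i * p) = x [^] m" by (rule periods)
  then have "x [^] m \<otimes> x [^] m = x [^] m" using x by (simp add: nat_pow_mult m_def)
  moreover have "0 < m" using p(1) by (simp add: m_def)
  ultimately show ?thesis by blast
qed

text \<open>Pigeonhole: if the length is the sum of all \<open>m x\<close>, some \<open>x\<close>
  occurs at least \<open>m x\<close> times, and \<open>m x\<close> copies of it multiply to an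
  idempotent. Hence the sets whose least elements define the two constants are nonempty.\<close>

lemma (in comm_monoid) has_idempotent_subproduct:
  assumes fin: "finite (carrier G)"
  shows "\<exists>t. has_subproduct_in G {x \<in> carrier G. x \<otimes> x = x} t"
proof -
  obtain m :: "'a \<Rightarrow> nat" where
    m: "\<And>x. x \<in> carrier G \<Longrightarrow> 0 < m x \<and> x [^] m x \<otimes> x [^] m x = x [^] m x"
    using finite_imp_idempotent_power[OF fin] by metis
  have "has_subproduct_in G {x \<in> carrier G. x \<otimes> x = x} (\<Sum>x\<in>carrier G. m x)"
    unfolding has_subproduct_in_def
  proof
    let ?t = "\<Sum>x\<in>carrier G. m x"
    fix s assume s: "s \<in> {..<?t} \<rightarrow> carrier G"
    have "\<exists>x\<in>carrier G. m x \<le> card {i \<in> {..<?t}. s i = x}"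
    proof (rule ccontr)
      assume "\<not> ?thesis"
      then have "(\<Sum>x\<in>carrier G. card {i \<in> {..<?t}. s i = x}) < ?t"
        using fin by (intro sum_strict_mono) auto
      moreover have "(\<Sum>x\<in>carrier G. card {i \<in> {..<?t}. s i = x})
          = card (\<Union>x\<in>carrier G. {i \<in> {..<?t}. s i = x})"
        using fin by (intro card_UN_disjoint[symmetric]) auto
      moreover have "(\<Union>x\<in>carrier G. {i \<in> {..<?t}. s i = x}) = {..<?t}"
        using s by auto
      ultimately show False by simp
    qed
    then obtain x where x: "x \<in> carrier G" "m x \<le> card {i \<in> {..<?t}. s i = x}" by blast
    obtain J where J: "J \<subseteq> {i \<in> {..<?t}. s i = x}" "card J = m x" "finite J"
      using obtain_subset_with_card_n[OF x(2)] by metis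
    have "finprod G s J = finprod G (\<lambda>_. x) J"
      using J(1) x(1) by (intro finprod_cong') auto
    also have "\<dots> = x [^] m x" using x(1) by (simp add: finprod_const J(2))
    finally have "finprod G s J \<in> {x \<in> carrier G. x \<otimes> x = x}" using m x(1) by simp
    moreover have "J \<noteq> {}" using J(2) m[OF x(1)] by auto
    moreover have "J \<subseteq> {..<?t}" using J(1) by auto
    ultimately show "\<exists>J \<subseteq> {..<?t}. J \<noteq> {} \<and> finprod G s J \<in> {x \<in> carrier G. x \<otimes> x = x}" by blast
  qed
  then show ?thesis by blast
qed

text \<open>The only idempotent of a group is \<open>\<one>\<close>, so the existence of idempotent
  subproducts specialises and the minimum is attained.\<close>

lemma (in comm_group) has_subproduct_in_davenport_constant:
  assumes "finite (carrier G)"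
  shows "has_subproduct_in G {\<one>} (davenport_constant G)"
proof -
  have "{x \<in> carrier G. x \<otimes> x = x} = {\<one>}" by auto
  then show ?thesis
    using has_idempotent_subproduct[OF assms] LeastI_ex[of "has_subproduct_in G {\<one>}"]
    by (auto simp: davenport_constant_eq)
qed

lemma (in comm_monoid) finprod_units_of:
  assumes "finite A" "s \<in> A \<rightarrow> Units G"
  shows "finprod (units_of G) s A = finprod G s A"
proof -
  interpret U: comm_group "units_of G" by (rule units_comm_group)
  show ?thesis using assms
  proof (induction A)
    case (insert i A)
    have "finprod (units_of G) s (insert i A) = s i \<otimes> finprod (units_of G) s A"
      using insert by (subst U.finprod_insert) (auto simp: units_of_carrier units_of_mult)
    also have "\<dots> = s i \<otimes> finprod G s A" using insert by simp
    also have "\<dots> = finprod G s (insert i A)"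
      using insert by (subst finprod_insert) (auto simp: Units_closed Pi_iff)
    finally show ?case .
  qed (simp add: units_of_one)
qed

lemma (in comm_monoid) finprod_Units_closed:
  assumes "finite A" "s \<in> A \<rightarrow> Units G"
  shows "finprod G s A \<in> Units G"
proof -
  interpret U: comm_group "units_of G" by (rule units_comm_group)
  have "finprod (units_of G) s A \<in> carrier (units_of G)"
    using assms(2) by (intro U.finprod_closed) (simp add: units_of_carrier)
  then show ?thesis using finprod_units_of[OF assms] by (simp add: units_of_carrier)
qed

text \<open>Products of units agree in \<open>G\<close> and in \<open>units_of G\<close>, so the
  Davenport constant of the unit group applies to the unit entries inside a larger sequence.\<close>

lemma (in comm_monoid) unit_subproduct_eq_one:
  assumes "finite (carrier G)" "finite A" "davenport_constant (units_of G) \<le> card A" "s \<in> A \<rightarrow> Units G"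
  shows "\<exists>J \<subseteq> A. J \<noteq> {} \<and> finprod G s J = \<one>"
proof -
  interpret U: comm_group "units_of G" by (rule units_comm_group)
  have "finite (carrier (units_of G))"
    using assms(1) by (auto simp: units_of_carrier Units_def intro: finite_subset[rotated])
  moreover have "s \<in> A \<rightarrow> carrier (units_of G)" using assms(4) by (simp add: units_of_carrier)
  ultimately have "\<exists>J \<subseteq> A. J \<noteq> {} \<and> finprod (units_of G) s J \<in> {\<one>\<^bsub>units_of G\<^esub>}"
    using U.has_subproduct_in_finite_set[OF U.has_subproduct_in_davenport_constant] assms(2,3) by blast
  then obtain J where J: "J \<subseteq> A" "J \<noteq> {}" "finprod (units_of G) s J = \<one>"
    by (auto simp: units_of_one)
  moreover have "finprod (units_of G) s J = finprod G s J"
    using J(1) assms(2,4) by (intro finprod_units_of) (auto intro: finite_subset)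
  ultimately show ?thesis by auto
qed

subsection \<open>Idempotent subproducts in finite commutative rings\<close>

lemma (in cring) ring_idempotent_iff: "ring_idempotent R x \<longleftrightarrow> x \<in> carrier R \<and> x \<otimes> x = x"
  by (auto simp: ring_idempotent_def numeral_2_eq_2)

lemma (in comm_monoid) idempotent_unit_eq_one:
  assumes "x \<in> Units G" "x \<otimes> x = x"
  shows "x = \<one>"
  using assms by (metis Units_closed Units_l_cancel r_one one_closed)

lemma (in cring) has_subproduct_in_idempotent_constant:
  assumes "finite (carrier R)"
  shows "has_subproduct_in R {x. ring_idempotent R x} (idempotent_constant R)"
  using has_idempotent_subproduct[OF assms] LeastI_ex[of "has_subproduct_in R {x. ring_idempotent R x}"]
  by (auto simp: idempotent_constant_eq ring_idempotent_iff)

text \<open>An extremal sequence of units without subproduct \<open>\<one>\<close> is extended by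
  the family \<open>g\<close>. Subproducts that use \<open>g\<close> are excluded by
  \<open>nonidem\<close>; a subproduct of units alone would be an idempotent unit, hence
  \<open>\<one>\<close>.\<close>

lemma (in cring) davenport_constant_le_idempotent_constant:
  assumes fin: "finite (carrier R)" and B: "finite B" "g \<in> B \<rightarrow> carrier R"
    and nonidem: "\<And>u K. u \<in> Units R \<Longrightarrow> K \<subseteq> B \<Longrightarrow> K \<noteq> {} \<Longrightarrow> \<not> ring_idempotent R (u \<otimes> finprod R g K)"
  shows "davenport_constant (units_of R) + card B \<le> idempotent_constant R"
proof (rule ccontr)
  interpret U: comm_group "units_of R" by (rule units_comm_group)
  let ?d = "davenport_constant (units_of R)"
  define m where "m = ?d - 1"
  assume less: "\<not> ?thesis"
  have "finite (carrier (units_of R))"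
    using fin by (auto simp: units_of_carrier Units_def intro: finite_subset[rotated])
  then have "0 < ?d" using U.has_subproduct_in_davenport_constant has_subproduct_in_pos by blast
  then have "m < ?d" by (simp add: m_def)
  then have "\<not> has_subproduct_in (units_of R) {\<one>} m"
    unfolding davenport_constant_eq by (auto dest: not_less_Least simp: units_of_one)
  then obtain s where s: "s \<in> {..<m} \<rightarrow> Units R"
    and s1: "\<And>J. J \<subseteq> {..<m} \<Longrightarrow> J \<noteq> {} \<Longrightarrow> finprod (units_of R) s J \<noteq> \<one>"
    unfolding has_subproduct_in_def by (auto simp: units_of_carrier)
  \<comment> \<open>The disjoint sum of the index sets concatenates the two sequences;
    \<open>J1\<close> and \<open>K\<close> below are the two parts of a subsequence.\<close>
  let ?A = "{..<m} <+> B" and ?f = "case_sum s g"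
  have f: "?f \<in> ?A \<rightarrow> carrier R" using s B(2) by (auto simp: Units_closed Pi_iff)
  \<comment> \<open>The negated claim puts the constant strictly below \<open>?d + card B\<close>;
    as \<open>?d\<close> is positive, it is at most \<open>m + card B\<close>.\<close>
  have "idempotent_constant R \<le> card ?A"
    using less \<open>0 < ?d\<close> B(1) by (simp add: card_Plus m_def)
  from has_subproduct_in_finite_set[OF has_subproduct_in_idempotent_constant[OF fin] _ this f]
  obtain J where J: "J \<subseteq> ?A" "J \<noteq> {}" "ring_idempotent R (finprod R ?f J)"
    using B(1) by auto
  define J1 K where "J1 = Inl -` J" and "K = Inr -` J"
  have J1: "J1 \<subseteq> {..<m}" and K: "K \<subseteq> B" using J(1) by (auto simp: J1_def K_def)
  have fin1: "finite J1" "finite K" using J1 K B(1) by (auto intro: finite_subset)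
  have J_eq: "J = Inl ` J1 \<union> Inr ` K"
  proof -
    have "x \<in> Inl ` J1 \<union> Inr ` K" if "x \<in> J" for x
      using that by (cases x) (auto simp: J1_def K_def)
    then show ?thesis by (auto simp: J1_def K_def)
  qed
  let ?u = "finprod R s J1"
  have u: "?u \<in> Units R" using fin1 s J1 by (intro finprod_Units_closed) auto
  have "finprod R ?f J = finprod R ?f (Inl ` J1) \<otimes> finprod R ?f (Inr ` K)"
    unfolding J_eq using f J(1) fin1 by (intro finprod_Un_disjoint) (auto simp: J_eq)
  also have "finprod R ?f (Inl ` J1) = ?u"
    using s J1 by (subst finprod_reindex) (auto simp: Pi_iff Units_closed subset_iff)
  also have "finprod R ?f (Inr ` K) = finprod R g K"
    using B(2) K by (subst finprod_reindex) (auto simp: Pi_iff subset_iff)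
  finally have idem: "ring_idempotent R (?u \<otimes> finprod R g K)" using J(3) by simp
  show False
  proof (cases "K = {}")
    case True
    have "?u = \<one>"
      using idem u by (intro idempotent_unit_eq_one) (auto simp: True ring_idempotent_iff Units_closed)
    moreover have "finprod (units_of R) s J1 = ?u"
      using s J1 fin1 by (intro finprod_units_of) auto
    ultimately show False using s1[OF J1] J(2) True by (auto simp: J_eq)
  next
    case False
    then show False using nonidem[OF u K] idem by blast
  qed
qed

text \<open>Either enough entries are units to give the subproduct \<open>\<one>\<close>, or
  \<open>n\<close> of them are multiples of \<open>p\<close>, and then
  \<open>p [^] n = \<zero>\<close> makes their product the idempotent
  \<open>\<zero>\<close>.\<close>

lemma (in cring) idempotent_constant_le_nilpotent:
  assumes fin: "finite (carrier R)" and p: "p \<in> carrier R" "p [^] n = \<zero>" and n: "0 < n"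
    and nonunit: "\<And>x. x \<in> carrier R \<Longrightarrow> x \<notin> Units R \<Longrightarrow> \<exists>y\<in>carrier R. x = p \<otimes> y"
  shows "idempotent_constant R \<le> davenport_constant (units_of R) + n - 1"
proof -
  let ?t = "davenport_constant (units_of R) + n - 1"
  have "has_subproduct_in R {x. ring_idempotent R x} ?t"
    unfolding has_subproduct_in_def
  proof
    fix s assume s: "s \<in> {..<?t} \<rightarrow> carrier R"
    let ?U = "{i \<in> {..<?t}. s i \<in> Units R}" and ?N = "{i \<in> {..<?t}. s i \<notin> Units R}"
    have "card ?U + card ?N = card (?U \<union> ?N)" by (intro card_Un_disjoint[symmetric]) auto
    also have "?U \<union> ?N = {..<?t}" by auto
    finally have "card ?U + card ?N = ?t" by simp
    \<comment> \<open>If both failed, the two counts would add up to at most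
      \<open>?t - 1\<close>.\<close>
    then consider "davenport_constant (units_of R) \<le> card ?U" | "n \<le> card ?N" using n by linarith
    then show "\<exists>J \<subseteq> {..<?t}. J \<noteq> {} \<and> finprod R s J \<in> {x. ring_idempotent R x}"
    proof cases
      case 1
      then have "\<exists>J \<subseteq> ?U. J \<noteq> {} \<and> finprod R s J = \<one>"
        by (intro unit_subproduct_eq_one[OF fin]) auto
      then obtain J where J: "J \<subseteq> ?U" "J \<noteq> {}" "finprod R s J = \<one>" by blast
      then have "ring_idempotent R (finprod R s J)" by (simp add: ring_idempotent_iff)
      then show ?thesis using J(1,2) by blast
    next
      case 2
      obtain J where J: "J \<subseteq> ?N" "card J = n" "finite J"
        using 2 by (rule obtain_subset_with_card_n)
      have "\<forall>i\<in>J. \<exists>y\<in>carrier R. s i = p \<otimes> y"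
        using J(1) s by (intro ballI nonunit) auto
      then obtain y where y: "\<And>i. i \<in> J \<Longrightarrow> y i \<in> carrier R \<and> s i = p \<otimes> y i" by metis
      have "finprod R s J = finprod R (\<lambda>i. p \<otimes> y i) J"
        using y p(1) by (intro finprod_cong') auto
      also have "\<dots> = finprod R (\<lambda>i. p) J \<otimes> finprod R y J"
        using y p(1) by (intro finprod_multf) auto
      also have "finprod R (\<lambda>i. p) J = \<zero>" using p by (simp add: finprod_const J(2))
      also have "\<zero> \<otimes> finprod R y J = \<zero>" using y by (intro l_null finprod_closed) auto
      finally have "ring_idempotent R (finprod R s J)" by (simp add: ring_idempotent_iff)
      moreover have "J \<noteq> {}" using J(2) n by auto
      ultimately show ?thesis using J(1) by blast
    qed
  qed
  then show ?thesis unfolding idempotent_constant_eq by (rule Least_le)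
qed

lemma (in cring) finprod_idempotent:
  assumes "finite A" "e \<in> A \<rightarrow> carrier R" "\<And>i. i \<in> A \<Longrightarrow> e i \<otimes> e i = e i"
  shows "finprod R e A \<otimes> finprod R e A = finprod R e A"
proof -
  have "finprod R e A \<otimes> finprod R e A = finprod R (\<lambda>i. e i \<otimes> e i) A"
    using assms(2) by (intro finprod_multf[symmetric]) auto
  also have "\<dots> = finprod R e A" using assms by (intro finprod_cong') auto
  finally show ?thesis .
qed

text \<open>Since \<open>red\<close> speaks of squares only, the exponent is halved, rounding up,
  until it reaches 1.\<close>

lemma (in cring) reduced_pow_eq_zero:
  assumes red: "\<And>x. x \<in> carrier R \<Longrightarrow> x \<otimes> x = \<zero> \<Longrightarrow> x = \<zero>"
    and x: "x \<in> carrier R" "x [^] (n::nat) = \<zero>" and n: "0 < n"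
  shows "x = \<zero>"
  using x n
proof (induction n arbitrary: x rule: less_induct)
  case (less n)
  show ?case
  proof (cases "n = 1")
    case True then show ?thesis using less.prems by simp
  next
    case False
    \<comment> \<open>Rounding up ensures \<open>n \<le> 2 * k\<close>, so the square of
      \<open>x [^] k\<close> is a multiple of \<open>x [^] n\<close>.\<close>
    define k where "k = (n + 1) div 2"
    have "x [^] k \<otimes> x [^] k = x [^] n \<otimes> x [^] (2 * k - n)"
      using less.prems(1) by (simp add: nat_pow_mult k_def mult_2)
    then have "x [^] k \<otimes> x [^] k = \<zero>" using less.prems by simp
    then have "x [^] k = \<zero>" by (rule red[OF nat_pow_closed[OF less.prems(1)]])
    moreover have "k < n" "0 < k" using False less.prems(3) by (auto simp: k_def)
    ultimately show ?thesis using less.IH less.prems(1) by metis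
  qed
qed

text \<open>An idempotent power \<open>e\<close> of \<open>x\<close> and
  \<open>f = \<one> \<ominus> e\<close> split the ring into two components. In that of
  \<open>f\<close>, \<open>x\<close> is nilpotent, hence zero; in that of \<open>e\<close>, it is
  invertible. Filling the zero component with \<open>f\<close> gives the unit
  \<open>x \<oplus> f\<close>.\<close>

lemma (in cring) reduced_eq_idempotent_mult_unit:
  assumes fin: "finite (carrier R)"
    and red: "\<And>x. x \<in> carrier R \<Longrightarrow> x \<otimes> x = \<zero> \<Longrightarrow> x = \<zero>"
    and x: "x \<in> carrier R"
  shows "\<exists>e\<in>carrier R. \<exists>u\<in>Units R. e \<otimes> e = e \<and> x = e \<otimes> u"
proof -
  obtain m :: nat where m: "0 < m" "x [^] m \<otimes> x [^] m = x [^] m"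
    using finite_imp_idempotent_power[OF fin x] by blast
  define e f where "e = x [^] m" and "f = \<one> \<ominus> e"
  have carr: "e \<in> carrier R" "f \<in> carrier R" using x by (auto simp: e_def f_def)
  have ee: "e \<otimes> e = e" using m(2) by (simp add: e_def)
  have ef: "e \<otimes> f = \<zero>" "f \<otimes> f = f"
    using ee carr(1) unfolding f_def by algebra+
  have fpow: "f [^] Suc k = f" for k
    by (induction k) (use ef(2) carr in \<open>simp_all\<close>)
  have "(x \<otimes> f) [^] m = e \<otimes> f"
    using x carr fpow[of "m - 1"] m(1) by (simp add: nat_pow_distrib e_def)
  then have xf: "x \<otimes> f = \<zero>"
    using reduced_pow_eq_zero[OF red, of "x \<otimes> f" m] x carr ef(1) m(1) by simp
  have e_f: "e \<oplus> f = \<one>" using carr(1) unfolding f_def by algebra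
  have "x \<otimes> e = x \<otimes> e \<oplus> x \<otimes> f" using x carr by (simp add: xf)
  also have "\<dots> = x" using x carr by (simp add: r_distr[symmetric] e_f)
  finally have xe: "x \<otimes> e = x" .
  \<comment> \<open>Then \<open>y \<otimes> e\<close> inverts \<open>x\<close> in the component of
    \<open>e\<close>, and \<open>f\<close> inverts itself in the other one, so
    \<open>y \<otimes> e \<oplus> f\<close> inverts \<open>x \<oplus> f\<close>.\<close>
  define y where "y = x [^] (m - 1)"
  have y: "y \<in> carrier R" "x \<otimes> y = e"
    using x m(1) nat_pow_Suc2[OF x, of "m - 1"] by (auto simp: y_def e_def)
  have "(x \<oplus> f) \<otimes> (y \<otimes> e \<oplus> f) = \<one>"
  proof -
    have "(x \<oplus> f) \<otimes> (y \<otimes> e \<oplus> f) = (x \<otimes> y) \<otimes> e \<oplus> x \<otimes> f \<oplus> y \<otimes> (e \<otimes> f) \<oplus> f \<otimes> f"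
      using x y(1) carr by algebra
    also have "\<dots> = e \<oplus> f" using carr y by (simp add: ee ef xf)
    finally show ?thesis by (simp add: e_f)
  qed
  then have "x \<oplus> f \<in> Units R"
    using x y(1) carr m_comm[of "x \<oplus> f" "y \<otimes> e \<oplus> f"]
    unfolding Units_def by (auto intro!: bexI[of _ "y \<otimes> e \<oplus> f"])
  moreover have "x = e \<otimes> (x \<oplus> f)"
    using x carr xe ef(1) by (simp add: r_distr m_comm[of e x])
  ultimately show ?thesis using ee carr(1) by blast
qed

text \<open>The set \<open>J\<close> is chosen by the unit parts alone; what remains is a product of
  idempotents, which is idempotent by commutativity.\<close>

lemma (in cring) idempotent_constant_le_reduced:
  assumes fin: "finite (carrier R)"
    and red: "\<And>x. x \<in> carrier R \<Longrightarrow> x \<otimes> x = \<zero> \<Longrightarrow> x = \<zero>"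
  shows "idempotent_constant R \<le> davenport_constant (units_of R)"
proof -
  let ?t = "davenport_constant (units_of R)"
  have "has_subproduct_in R {x. ring_idempotent R x} ?t"
    unfolding has_subproduct_in_def
  proof
    fix s assume s: "s \<in> {..<?t} \<rightarrow> carrier R"
    have "\<exists>e u. e \<in> carrier R \<and> u \<in> Units R \<and> e \<otimes> e = e \<and> s i = e \<otimes> u" if "i < ?t" for i
    proof -
      have "s i \<in> carrier R" using s that by auto
      from reduced_eq_idempotent_mult_unit[OF fin red this] show ?thesis by blast
    qed
    then obtain e u where eu: "\<And>i. i < ?t \<Longrightarrow>
        e i \<in> carrier R \<and> u i \<in> Units R \<and> e i \<otimes> e i = e i \<and> s i = e i \<otimes> u i"
      by metis
    have "\<exists>J \<subseteq> {..<?t}. J \<noteq> {} \<and> finprod R u J = \<one>"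
      using eu by (intro unit_subproduct_eq_one[OF fin]) auto
    then obtain J where J: "J \<subseteq> {..<?t}" "J \<noteq> {}" "finprod R u J = \<one>" by blast
    have e: "e \<in> J \<rightarrow> carrier R" and u: "u \<in> J \<rightarrow> carrier R" using J(1) eu by (auto simp: Units_closed)
    have "finprod R s J = finprod R (\<lambda>i. e i \<otimes> u i) J"
      using J(1) eu by (intro finprod_cong') (auto simp: Units_closed subset_iff)
    also have "\<dots> = finprod R e J"
      using e u J(3) by simp
    finally have "ring_idempotent R (finprod R s J)"
      using finprod_idempotent[of J e] J(1) e eu by (auto simp: ring_idempotent_iff intro: finite_subset)
    then show "\<exists>J \<subseteq> {..<?t}. J \<noteq> {} \<and> finprod R s J \<in> {x. ring_idempotent R x}" using J by blast
  qed
  then show ?thesis unfolding idempotent_constant_eq by (rule Least_le)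
qed

subsection \<open>Primes in a domain and its quotients\<close>

text \<open>Write \<open>p = q \<otimes> c\<close>. Primality of \<open>p\<close> leaves
  \<open>p divides q\<close>, as wanted, or \<open>p divides c\<close>; in the latter case
  cancelling \<open>p\<close> would make \<open>q\<close> a unit.\<close>

lemma (in domain) prime_divides_prime_imp_assoc:
  assumes p: "p \<in> carrier R" "ring_prime p" and q: "q \<in> carrier R" "ring_prime q"
    and dvd: "q divides p"
  shows "q \<sim> p"
proof -
  have p0: "p \<noteq> \<zero>" "prime R p" and q0: "q \<notin> Units R"
    using ring_primeE[OF p] ring_primeE[OF q] by (auto simp: prime_def)
  obtain c where c: "c \<in> carrier R" "p = q \<otimes> c" using dvd by (auto simp: factor_def)
  have "p divides q \<otimes> c" using c(2) p(1) by simp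
  then have "p divides q \<or> p divides c" using p0(2) c(1) q(1) by (auto simp: prime_def)
  moreover have False if pc: "p divides c"
  proof -
    obtain d where d: "d \<in> carrier R" "c = p \<otimes> d" using pc by (rule dividesE)
    have "p \<otimes> (q \<otimes> d) = q \<otimes> c" using d p(1) q(1) by (simp add: m_lcomm)
    then have "p \<otimes> (q \<otimes> d) = p \<otimes> \<one>" using c(2) p(1) by simp
    then have "q \<otimes> d = \<one>"
      using m_lcancel[of p "q \<otimes> d" \<one>] p0(1) p(1) q(1) d(1) by blast
    then have "q \<in> Units R"
      using divides_one[OF q(1)] d(1) by (metis dividesI')
    then show False using q0 by simp
  qed
  ultimately show ?thesis using dvd by (auto simp: associated_def)
qed

text \<open>The classes counted by \<open>small_omega\<close> live in \<open>mult_of R\<close>,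
  while the divisibility arguments run in \<open>R\<close>; on nonzero elements the two notions of
  associates agree.\<close>

lemma (in domain) assocs_mult_of_eq_iff:
  assumes "p \<in> carrier R - {\<zero>}" "q \<in> carrier R - {\<zero>}"
  shows "assocs (mult_of R) p = assocs (mult_of R) q \<longleftrightarrow> p \<sim> q"
proof
  assume "assocs (mult_of R) p = assocs (mult_of R) q"
  then have "q \<sim>\<^bsub>mult_of R\<^esub> p"
    using assms by (intro mult_of.assocs_eqD) auto
  then have "q \<sim> p" using assms by (simp add: assoc_iff_assoc_mult)
  then show "p \<sim> q" by (rule associated_sym)
next
  assume "p \<sim> q"
  then have pq: "p \<sim>\<^bsub>mult_of R\<^esub> q" using assms assoc_iff_assoc_mult[of p q] by simp
  have "map (assocs (mult_of R)) [p] = map (assocs (mult_of R)) [q]"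
    by (rule mult_of.eqc_listassoc_cong) (use pq assms in auto)
  then show "assocs (mult_of R) p = assocs (mult_of R) q" by simp
qed

text \<open>Keeping one prime of each class of associates in \<open>r\<close> leaves \<open>\<Omega> - \<omega>\<close> primes \<open>gs\<close>, all of whose
  classes still occur in \<open>r\<close>.\<close>

lemma (in domain) prime_list_split_radical:
  assumes "set fs \<subseteq> carrier R" "\<And>q. q \<in> set fs \<Longrightarrow> ring_prime q"
  shows "\<exists>gs r. set gs \<subseteq> set fs \<and> r \<in> carrier R
    \<and> length gs + card (assocs (mult_of R) ` set fs) = length fs
    \<and> foldr (\<otimes>) fs \<one> = foldr (\<otimes>) gs \<one> \<otimes> r
    \<and> (\<forall>q\<in>set fs. q divides r)
    \<and> (\<forall>x\<in>carrier R. (\<forall>q\<in>set fs. q divides x) \<longrightarrow> r divides x)"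
  using assms
proof (induction fs)
  case Nil
  show ?case by (intro exI[of _ "[]"] exI[of _ \<one>]) (auto simp: one_divides)
next
  case (Cons p fs)
  let ?cl = "assocs (mult_of R)"
  have p: "p \<in> carrier R" "ring_prime p" and fs: "set fs \<subseteq> carrier R" "\<And>q. q \<in> set fs \<Longrightarrow> ring_prime q"
    using Cons.prems by auto
  obtain gs r where gs: "set gs \<subseteq> set fs" and r: "r \<in> carrier R"
    and len: "length gs + card (?cl ` set fs) = length fs"
    and prod: "foldr (\<otimes>) fs \<one> = foldr (\<otimes>) gs \<one> \<otimes> r"
    and dvd: "\<And>q. q \<in> set fs \<Longrightarrow> q divides r"
    and rad: "\<And>x. x \<in> carrier R \<Longrightarrow> (\<And>q. q \<in> set fs \<Longrightarrow> q divides x) \<Longrightarrow> r divides x"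
    using Cons.IH[OF fs] by metis
  have prod_gs: "foldr (\<otimes>) gs \<one> \<in> carrier R" using gs fs(1) by (intro multlist_closed) auto
  show ?case
  proof (cases "?cl p \<in> ?cl ` set fs")
    \<comment> \<open>The class of \<open>p\<close> already occurs, so \<open>p\<close> joins
      \<open>gs\<close>; it divides \<open>r\<close> because its associate \<open>q\<close>
      does.\<close>
    case True
    then obtain q where q: "q \<in> set fs" "?cl p = ?cl q" by auto
    then have "p \<sim> q"
      using p fs assocs_mult_of_eq_iff[of p q] ring_primeE(1)[OF p] ring_primeE(1)[of q] by auto
    then have "p divides r"
      using divides_trans[of p q r] dvd[OF q(1)] p(1) by (auto simp: associated_def)
    moreover have "?cl ` set (p # fs) = ?cl ` set fs" using True by auto
    moreover have "foldr (\<otimes>) (p # fs) \<one> = foldr (\<otimes>) (p # gs) \<one> \<otimes> r"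
      using prod prod_gs p(1) r by (simp add: m_assoc)
    ultimately show ?thesis
      using gs r len dvd rad by (intro exI[of _ "p # gs"] exI[of _ r]) auto
  next
    \<comment> \<open>The class is new, so \<open>p\<close> joins \<open>r\<close>. For a common
      multiple \<open>x = p \<otimes> y\<close>, each earlier prime divides \<open>y\<close>,
      because it would be associated to \<open>p\<close> if it divided \<open>p\<close>.\<close>
    case False
    have "p \<otimes> r divides x" if x: "x \<in> carrier R" "\<forall>q\<in>set (p # fs). q divides x" for x
    proof -
      obtain y where y: "y \<in> carrier R" "x = p \<otimes> y" using x(2) by (auto simp: factor_def)
      have "q divides y" if q: "q \<in> set fs" for q
      proof -
        have qc: "q \<in> carrier R" "ring_prime q" using fs q by auto
        have "\<not> q divides p"
        proof
          assume "q divides p"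
          then have "q \<sim> p" by (rule prime_divides_prime_imp_assoc[OF p qc])
          then have "?cl q = ?cl p"
            using p(1) qc(1) ring_primeE(1)[OF p] ring_primeE(1)[OF qc]
            by (intro assocs_mult_of_eq_iff[THEN iffD2]) auto
          then have "?cl p \<in> ?cl ` set fs" using q by (intro image_eqI[of _ _ q]) auto
          then show False using False by contradiction
        qed
        moreover have "q divides p \<otimes> y" using x(2) q y(2) by auto
        ultimately show ?thesis
          using ring_primeE(3)[OF qc] p(1) y(1) by (auto simp: prime_def)
      qed
      then have "r divides y" by (rule rad[OF y(1)])
      then show ?thesis unfolding y(2) using r p(1) by (intro divides_mult)
    qed
    moreover have "q divides p \<otimes> r" if "q \<in> set (p # fs)" for q
    proof (cases "q = p")
      case True then show ?thesis using r by (auto simp: factor_def)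
    next
      case False
      then have "q \<in> set fs" using that by auto
      then show ?thesis
        using dvd p(1) r fs(1) by (intro divides_prod_l) auto
    qed
    moreover have "length gs + card (?cl ` set (p # fs)) = length (p # fs)"
      using len False by (simp add: card_insert_if)
    moreover have "foldr (\<otimes>) (p # fs) \<one> = foldr (\<otimes>) gs \<one> \<otimes> (p \<otimes> r)"
      using prod prod_gs p(1) r by (simp add: m_lcomm)
    moreover have "set gs \<subseteq> set (p # fs)" using gs by auto
    moreover have "p \<otimes> r \<in> carrier R" using p(1) r by simp
    ultimately show ?thesis by blast
  qed
qed

text \<open>Indexing by positions turns subsequences of the list into sets, even when primes
  repeat.\<close>

lemma (in comm_monoid) foldr_mult_eq_finprod:
  assumes "set gs \<subseteq> carrier G"
  shows "foldr (\<otimes>) gs \<one> = finprod G (\<lambda>i. gs ! i) {..<length gs}"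
  using assms
proof (induction gs)
  case (Cons g gs)
  then have nth: "gs ! i \<in> carrier G" if "i < length gs" for i using that by auto
  have "finprod G (\<lambda>i. (g # gs) ! i) {..<length (g # gs)}
      = g \<otimes> finprod G (\<lambda>i. (g # gs) ! i) (Suc ` {..<length gs})"
    unfolding length_Cons lessThan_Suc_eq_insert_0
    using Cons.prems nth by (subst finprod_insert) auto
  also have "finprod G (\<lambda>i. (g # gs) ! i) (Suc ` {..<length gs}) = finprod G (\<lambda>i. gs ! i) {..<length gs}"
    using nth by (subst finprod_reindex) auto
  finally show ?case using Cons by simp
qed simp

text \<open>The core of the lower bound. Cancelling \<open>d\<close> leaves \<open>k\<close>, hence
  \<open>q\<close>, dividing \<open>u \<otimes> (u \<otimes> d \<ominus> \<one>)\<close>; as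
  \<open>q\<close> divides \<open>d\<close> but not \<open>u\<close>, it would divide
  \<open>\<one>\<close>.\<close>

lemma (in domain) not_divides_square_diff:
  assumes carr: "u \<in> carrier R" "d \<in> carrier R" "k \<in> carrier R" and d: "d \<noteq> \<zero>"
    and q: "q \<in> carrier R" "ring_prime q" "q divides d" "q divides k" "\<not> q divides u"
  shows "\<not> d \<otimes> k divides ((u \<otimes> d) \<otimes> (u \<otimes> d) \<ominus> u \<otimes> d)"
proof
  assume "d \<otimes> k divides ((u \<otimes> d) \<otimes> (u \<otimes> d) \<ominus> u \<otimes> d)"
  moreover have "(u \<otimes> d) \<otimes> (u \<otimes> d) \<ominus> u \<otimes> d = d \<otimes> (u \<otimes> (u \<otimes> d \<ominus> \<one>))"
    using carr by algebra
  ultimately have "k divides u \<otimes> (u \<otimes> d \<ominus> \<one>)"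
    using mult_divides[of k "u \<otimes> (u \<otimes> d \<ominus> \<one>)" d] carr d by simp
  then have "q divides u \<otimes> (u \<otimes> d \<ominus> \<one>)" using q(1,4) divides_trans by blast
  then have "q divides (u \<otimes> d \<ominus> \<one>)"
    using ring_primeE(3)[OF q(1,2)] q(5) carr by (auto simp: prime_def)
  then obtain x where x: "x \<in> carrier R" "u \<otimes> d \<ominus> \<one> = q \<otimes> x" by (auto simp: factor_def)
  obtain y where y: "y \<in> carrier R" "d = q \<otimes> y" using q(3) by (auto simp: factor_def)
  have "\<one> = u \<otimes> d \<ominus> (u \<otimes> d \<ominus> \<one>)" using carr by algebra
  also have "\<dots> = u \<otimes> d \<ominus> q \<otimes> x" by (simp only: x(2))
  also have "\<dots> = q \<otimes> (u \<otimes> y \<ominus> x)" unfolding y(2) using carr(1) q(1) x(1) y(1) by algebra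
  finally have "q divides \<one>" using carr(1) x(1) y(1) by (intro dividesI[of "u \<otimes> y \<ominus> x"]) auto
  then show False using divides_one[OF q(1)] ring_primeE(3)[OF q(1,2)] by (simp add: prime_def)
qed

section \<open>The quotient map and divisibility by \<open>a\<close>\<close>

lemma (in cring) quotient_coset_hom:
  assumes a: "a \<in> carrier R"
  shows "ring_hom_cring R (R Quot (PIdl a)) (\<lambda>x. PIdl a +> x)"
  by (rule ideal.rcos_ring_hom_cring[OF cgenideal_ideal[OF a] is_cring])

lemma (in cring) coset_eq_zero_iff:
  assumes a: "a \<in> carrier R" and x: "x \<in> carrier R"
  shows "PIdl a +> x = \<zero>\<^bsub>R Quot (PIdl a)\<^esub> \<longleftrightarrow> a divides x"
proof -
  interpret I: ideal "PIdl a" R by (rule cgenideal_ideal[OF a])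
  have "PIdl a +> x = PIdl a \<longleftrightarrow> x \<in> PIdl a"
    using I.rcos_const_imp_mem[OF x] a_rcos_zero[OF I.ideal_axioms] by blast
  also have "\<dots> \<longleftrightarrow> (\<exists>r\<in>carrier R. x = r \<otimes> a)" unfolding cgenideal_def by blast
  also have "\<dots> \<longleftrightarrow> a divides x"
    unfolding factor_def by (rule bex_cong) (simp_all add: m_comm[OF a])
  finally show ?thesis by (simp add: FactRing_def)
qed

lemma carrier_FactRing: "carrier (R Quot I) = (\<lambda>x. I +>\<^bsub>R\<^esub> x) ` carrier R"
  unfolding FactRing_def partial_object.simps A_RCOSETS_def' by blast

text \<open>The residues of \<open>gs\<close> form the family appended to the units. That a unit
  times a nonempty subproduct of them is never idempotent is checked after lifting to
  \<open>R\<close>, by \<open>not_divides_square_diff\<close>.\<close>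

lemma (in domain) davenport_add_length_le_idempotent_constant:
  assumes a: "a \<in> carrier R" "a \<noteq> \<zero>" and fin: "finite (carrier (R Quot (PIdl a)))"
    and gs: "set gs \<subseteq> carrier R" "\<And>q. q \<in> set gs \<Longrightarrow> ring_prime q"
    and r: "r \<in> carrier R" "\<And>q. q \<in> set gs \<Longrightarrow> q divides r"
    and assoc: "foldr (\<otimes>) gs \<one> \<otimes> r \<sim> a"
  shows "davenport_constant (units_of (R Quot (PIdl a))) + length gs
    \<le> idempotent_constant (R Quot (PIdl a))"
proof -
  define T where "T = R Quot (PIdl a)"
  define h where "h = (\<lambda>x. PIdl a +> x)"
  interpret h: ring_hom_cring R T h
    unfolding T_def h_def by (rule quotient_coset_hom[OF a(1)])
  have T: "carrier T = h ` carrier R" by (simp add: T_def h_def carrier_FactRing)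
  have h0: "h x = \<zero>\<^bsub>T\<^esub> \<longleftrightarrow> a divides x" if "x \<in> carrier R" for x
    using coset_eq_zero_iff[OF a(1) that] by (simp add: T_def h_def)
  have nth: "(\<lambda>i. gs ! i) \<in> {..<length gs} \<rightarrow> carrier R" using gs(1) by auto
  have "davenport_constant (units_of T) + card {..<length gs} \<le> idempotent_constant T"
  proof (rule h.S.davenport_constant_le_idempotent_constant)
    show "finite (carrier T)" using fin by (simp add: T_def)
    show "(\<lambda>i. h (gs ! i)) \<in> {..<length gs} \<rightarrow> carrier T" using nth by auto
    fix u' K assume u': "u' \<in> Units T" and K: "K \<subseteq> {..<length gs}" "K \<noteq> {}"
    obtain u v where u: "u \<in> carrier R" "u' = h u" and v: "v \<in> carrier R" "h u \<otimes>\<^bsub>T\<^esub> h v = \<one>\<^bsub>T\<^esub>"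
      using u' by (auto simp: Units_def T)
    \<comment> \<open>Here \<open>d\<close> is the chosen subproduct and \<open>e\<close> the
      complementary one, so \<open>a\<close> is associated to \<open>d \<otimes> k\<close> with
      \<open>k = e \<otimes> r\<close>.\<close>
    define d e where "d = finprod R (\<lambda>i. gs ! i) K" and "e = finprod R (\<lambda>i. gs ! i) ({..<length gs} - K)"
    have nthK: "(\<lambda>i. gs ! i) \<in> K \<rightarrow> carrier R" "(\<lambda>i. gs ! i) \<in> ({..<length gs} - K) \<rightarrow> carrier R"
      using nth K(1) by auto
    have carr: "d \<in> carrier R" "e \<in> carrier R" using nthK by (auto simp: d_def e_def)
    have hd: "finprod T (\<lambda>i. h (gs ! i)) K = h d"
      unfolding d_def using h.hom_finprod[OF nthK(1)] by (simp add: comp_def)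
    have finK: "finite K" using K(1) finite_subset by blast
    have "finprod R (\<lambda>i. gs ! i) (K \<union> ({..<length gs} - K)) = d \<otimes> e"
      unfolding d_def e_def using nthK finK by (intro finprod_Un_disjoint) auto
    moreover have "K \<union> ({..<length gs} - K) = {..<length gs}" using K(1) by auto
    ultimately have "foldr (\<otimes>) gs \<one> = d \<otimes> e" by (simp add: foldr_mult_eq_finprod[OF gs(1)])
    then have "d \<otimes> (e \<otimes> r) \<sim> a" using assoc carr r(1) by (simp add: m_assoc)
    then have dk: "d \<otimes> (e \<otimes> r) divides a" "a divides d \<otimes> (e \<otimes> r)" by (auto simp: associated_def)
    have d0: "d \<noteq> \<zero>"
    proof
      assume "d = \<zero>"
      then show False using dk(1) carr r(1) a by (simp add: zero_divides)
    qed
    \<comment> \<open>Any prime at a position in \<open>K\<close> serves: it divides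
      \<open>d\<close> as one of its factors and \<open>r\<close> by assumption.\<close>
    obtain j where j: "j \<in> K" using K(2) by blast
    define q where "q = gs ! j"
    have "q \<in> set gs" using j K(1) by (auto simp: q_def)
    then have q: "q \<in> carrier R" "ring_prime q" "q divides r" using gs r(2) by auto
    have "d = q \<otimes> finprod R (\<lambda>i. gs ! i) (K - {j})"
    proof -
      have "d = finprod R (\<lambda>i. gs ! i) (insert j (K - {j}))" using j by (simp add: d_def insert_absorb)
      also have "\<dots> = q \<otimes> finprod R (\<lambda>i. gs ! i) (K - {j})"
        unfolding q_def using finK nthK j by (intro finprod_insert) auto
      finally show ?thesis .
    qed
    moreover have "finprod R (\<lambda>i. gs ! i) (K - {j}) \<in> carrier R" using nthK by (intro finprod_closed) auto
    ultimately have qd: "q divides d" by (metis dividesI')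
    have "q divides d \<otimes> (e \<otimes> r)" using qd q(1) carr r(1) by (intro divides_prod_r) auto
    then have qa: "q divides a" using dk(1) q(1) by (rule divides_trans)
    \<comment> \<open>Since \<open>u \<otimes> v\<close> is \<open>\<one>\<close> modulo
      \<open>a\<close>, hence modulo \<open>q\<close>, a \<open>q\<close> dividing \<open>u\<close>
      would divide \<open>\<one>\<close>.\<close>
    have "\<not> q divides u"
    proof
      assume "q divides u"
      then have "q divides u \<otimes> v" using q(1) u(1) v(1) by (intro divides_prod_r)
      moreover have "h (u \<otimes> v \<ominus> \<one>) = \<zero>\<^bsub>T\<^esub>"
        using u(1) v by (simp add: a_minus_def h.S.r_neg)
      then have "a divides (u \<otimes> v \<ominus> \<one>)"
        using u(1) v(1) by (intro h0[THEN iffD1]) auto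
      then have "q divides (u \<otimes> v \<ominus> \<one>)" using qa q(1) divides_trans by blast
      ultimately obtain x y where xy: "x \<in> carrier R" "u \<otimes> v = q \<otimes> x" "y \<in> carrier R" "u \<otimes> v \<ominus> \<one> = q \<otimes> y"
        by (auto simp: factor_def)
      have "\<one> = u \<otimes> v \<ominus> (u \<otimes> v \<ominus> \<one>)" using u(1) v(1) by algebra
      also have "\<dots> = u \<otimes> v \<ominus> q \<otimes> y" by (simp only: xy(4))
      also have "\<dots> = q \<otimes> (x \<ominus> y)" unfolding xy(2) using xy(1,3) q(1) by algebra
      finally have "q divides \<one>" using xy by (intro dividesI[of "x \<ominus> y"]) auto
      then show False using divides_one[OF q(1)] ring_primeE(3)[OF q(1,2)] by (simp add: prime_def)
    qed
    moreover have "q divides e \<otimes> r" using q carr r(1) by (intro divides_prod_l)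
    ultimately have ndvd: "\<not> d \<otimes> (e \<otimes> r) divides ((u \<otimes> d) \<otimes> (u \<otimes> d) \<ominus> u \<otimes> d)"
      using not_divides_square_diff[OF u(1) carr(1) _ d0 q(1,2) qd] carr(2) r(1) by simp
    show "\<not> ring_idempotent T (u' \<otimes>\<^bsub>T\<^esub> finprod T (\<lambda>i. h (gs ! i)) K)"
    proof
      assume "ring_idempotent T (u' \<otimes>\<^bsub>T\<^esub> finprod T (\<lambda>i. h (gs ! i)) K)"
      then have "h (u \<otimes> d) \<otimes>\<^bsub>T\<^esub> h (u \<otimes> d) = h (u \<otimes> d)"
        using u carr by (simp add: h.S.ring_idempotent_iff hd)
      then have "h ((u \<otimes> d) \<otimes> (u \<otimes> d) \<ominus> u \<otimes> d) = \<zero>\<^bsub>T\<^esub>"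
        using u(1) carr by (simp add: a_minus_def h.S.r_neg)
      then have "a divides ((u \<otimes> d) \<otimes> (u \<otimes> d) \<ominus> u \<otimes> d)"
        using u(1) carr by (intro h0[THEN iffD1]) auto
      with dk(1) have "d \<otimes> (e \<otimes> r) divides ((u \<otimes> d) \<otimes> (u \<otimes> d) \<ominus> u \<otimes> d)"
        by (rule divides_trans) (use carr r(1) in simp)
      then show False using ndvd by contradiction
    qed
  qed simp
  then show ?thesis by (simp add: T_def)
qed

section \<open>Upper bounds for the quotient\<close>

text \<open>The assumption \<open>red\<close> is reducedness of the quotient, read in
  \<open>R\<close>. The bound serves squarefree \<open>a\<close>, units and \<open>\<zero>\<close>
  alike.\<close>

lemma (in cring) idempotent_constant_quotient_le_reduced:
  assumes a: "a \<in> carrier R" and fin: "finite (carrier (R Quot (PIdl a)))"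
    and red: "\<And>x. x \<in> carrier R \<Longrightarrow> a divides x \<otimes> x \<Longrightarrow> a divides x"
  shows "idempotent_constant (R Quot (PIdl a)) \<le> davenport_constant (units_of (R Quot (PIdl a)))"
proof -
  define T h where "T = R Quot (PIdl a)" and "h = (\<lambda>x. PIdl a +> x)"
  interpret h: ring_hom_cring R T h
    unfolding T_def h_def by (rule quotient_coset_hom[OF a])
  have h0: "h x = \<zero>\<^bsub>T\<^esub> \<longleftrightarrow> a divides x" if "x \<in> carrier R" for x
    using coset_eq_zero_iff[OF a that] by (simp add: T_def h_def)
  have "idempotent_constant T \<le> davenport_constant (units_of T)"
  proof (rule h.S.idempotent_constant_le_reduced)
    show "finite (carrier T)" using fin by (simp add: T_def)
    fix y assume y: "y \<in> carrier T" "y \<otimes>\<^bsub>T\<^esub> y = \<zero>\<^bsub>T\<^esub>"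
    then obtain x where x: "x \<in> carrier R" "y = h x" by (auto simp: T_def h_def carrier_FactRing)
    then have "h (x \<otimes> x) = \<zero>\<^bsub>T\<^esub>" using y(2) by simp
    then have "a divides x \<otimes> x" using x(1) by (intro h0[THEN iffD1]) auto
    then have "a divides x" by (rule red[OF x(1)])
    then show "y = \<zero>\<^bsub>T\<^esub>" unfolding x(2) by (rule h0[OF x(1), THEN iffD2])
  qed
  then show ?thesis by (simp add: T_def)
qed

text \<open>The corresponding fact holds in the cancellative monoid \<open>mult_of R\<close> of
  nonzero elements; \<open>x\<close> is nonzero because \<open>p\<close> does not divide it, and
  \<open>y = \<zero>\<close> is treated apart.\<close>

lemma (in domain) prime_power_divides_mult:
  assumes p: "p \<in> carrier R" "ring_prime p" and x: "x \<in> carrier R" and y: "y \<in> carrier R"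
    and dvd: "p [^] (n::nat) divides x \<otimes> y" and ndvd: "\<not> p divides x"
  shows "p [^] n divides y"
proof (cases "y = \<zero>")
  case True
  then show ?thesis using p(1) by (simp add: divides_zero)
next
  case False
  have x0: "x \<noteq> \<zero>" using ndvd p(1) divides_zero by blast
  have "p [^]\<^bsub>mult_of R\<^esub> n divides\<^bsub>mult_of R\<^esub> (x \<otimes> y)"
    unfolding nat_pow_mult_of
    using dvd p(1) x y x0 False by (intro divides_imp_divides_mult) (auto simp: integral_iff)
  moreover have "\<not> p divides\<^bsub>mult_of R\<^esub> x" by (rule contrapos_nn[OF ndvd divides_mult_imp_divides])
  ultimately have "p [^]\<^bsub>mult_of R\<^esub> n divides\<^bsub>mult_of R\<^esub> y"
    using mult_of.prime_pow_divides_iff[of p x y n] ring_primeE[OF p] p(1) x y x0 False by simp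
  then show ?thesis unfolding nat_pow_mult_of by (rule divides_mult_imp_divides)
qed

text \<open>It has to be shown that a nonunit residue is a multiple of \<open>p\<close>. A factorial
  domain need not have Bezout identities, so finiteness is used: some power of the residue is
  idempotent, and if \<open>p\<close> does not divide \<open>x\<close> that power is
  \<open>\<one>\<close>.\<close>

lemma (in domain) idempotent_constant_quotient_le_prime_power:
  assumes a: "a \<in> carrier R" and fin: "finite (carrier (R Quot (PIdl a)))"
    and p: "p \<in> carrier R" "ring_prime p" and assoc: "a \<sim> p [^] (n::nat)" and n: "0 < n"
  shows "idempotent_constant (R Quot (PIdl a)) \<le> davenport_constant (units_of (R Quot (PIdl a))) + n - 1"
proof -
  define T h where "T = R Quot (PIdl a)" and "h = (\<lambda>x. PIdl a +> x)"
  interpret h: ring_hom_cring R T h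
    unfolding T_def h_def by (rule quotient_coset_hom[OF a])
  have h0: "h x = \<zero>\<^bsub>T\<^esub> \<longleftrightarrow> a divides x" if "x \<in> carrier R" for x
    using coset_eq_zero_iff[OF a that] by (simp add: T_def h_def)
  have finT: "finite (carrier T)" using fin by (simp add: T_def)
  have hpow: "h x [^]\<^bsub>T\<^esub> m = h (x [^] m)" if "x \<in> carrier R" for x and m :: nat
    using that by (induction m) auto
  have ap: "a divides p [^] n" "p [^] n divides a" using assoc by (auto simp: associated_def)
  have "idempotent_constant T \<le> davenport_constant (units_of T) + n - 1"
  proof (rule h.S.idempotent_constant_le_nilpotent[OF finT _ _ n])
    show "h p \<in> carrier T" using p(1) by simp
    show "h p [^]\<^bsub>T\<^esub> n = \<zero>\<^bsub>T\<^esub>"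
      unfolding hpow[OF p(1)] by (rule h0[THEN iffD2]) (use ap p(1) in auto)
    fix z assume z: "z \<in> carrier T" "z \<notin> Units T"
    then obtain x where x: "x \<in> carrier R" "z = h x" by (auto simp: T_def h_def carrier_FactRing)
    have "p divides x"
    proof (rule ccontr)
      assume ndvd: "\<not> p divides x"
      obtain m :: nat where m: "0 < m" "z [^]\<^bsub>T\<^esub> m \<otimes>\<^bsub>T\<^esub> z [^]\<^bsub>T\<^esub> m = z [^]\<^bsub>T\<^esub> m"
        using h.S.finite_imp_idempotent_power[OF finT z(1)] by blast
      define e where "e = x [^] m"
      have e: "e \<in> carrier R" "z [^]\<^bsub>T\<^esub> m = h e"
        using x(1) unfolding x(2) e_def hpow[OF x(1)] by simp_all
      have "\<not> p divides x [^] k" for k :: nat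
      proof (induction k)
        case 0
        then show ?case using divides_one[OF p(1)] ring_primeE(3)[OF p] by (simp add: prime_def)
      next
        case (Suc k)
        then show ?case using ndvd ring_primeE(3)[OF p] x(1) by (auto simp: prime_def)
      qed
      then have ndvd_e: "\<not> p divides e" by (simp add: e_def)
      \<comment> \<open>Idempotence says that \<open>p [^] n\<close> divides
        \<open>e \<otimes> (e \<ominus> \<one>)\<close>; as \<open>p\<close> does not divide
        \<open>e\<close>, all of \<open>p [^] n\<close> goes into
        \<open>e \<ominus> \<one>\<close>.\<close>
      have "h (e \<otimes> (e \<ominus> \<one>)) = h e \<otimes>\<^bsub>T\<^esub> (h e \<ominus>\<^bsub>T\<^esub> \<one>\<^bsub>T\<^esub>)"
        using e(1) by (simp add: a_minus_def)
      also have "\<dots> = h e \<otimes>\<^bsub>T\<^esub> h e \<ominus>\<^bsub>T\<^esub> h e"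
        using e(1) h.hom_closed[OF e(1)] by algebra
      also have "\<dots> = \<zero>\<^bsub>T\<^esub>"
        using m(2) h.hom_closed[OF e(1)] unfolding e(2) by (simp add: a_minus_def h.S.r_neg)
      finally have "a divides e \<otimes> (e \<ominus> \<one>)"
        using e(1) by (intro h0[THEN iffD1]) auto
      with ap(2) have "p [^] n divides e \<otimes> (e \<ominus> \<one>)"
        by (rule divides_trans) (use p(1) in simp)
      then have "p [^] n divides (e \<ominus> \<one>)"
        using prime_power_divides_mult[OF p e(1) _ _ ndvd_e] e(1) by simp
      with ap(1) have "a divides (e \<ominus> \<one>)" by (rule divides_trans[OF _ _ a])
      then have "h (e \<ominus> \<one>) = \<zero>\<^bsub>T\<^esub>" using e(1) by (intro h0[THEN iffD2]) auto
      then have "h e \<ominus>\<^bsub>T\<^esub> \<one>\<^bsub>T\<^esub> = \<zero>\<^bsub>T\<^esub>" using e(1) by (simp add: a_minus_def)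
      then have "z [^]\<^bsub>T\<^esub> m = \<one>\<^bsub>T\<^esub>" using e h.S.r_right_minus_eq[of "h e" "\<one>\<^bsub>T\<^esub>"] by simp
      then have "z \<otimes>\<^bsub>T\<^esub> z [^]\<^bsub>T\<^esub> (m - 1) = \<one>\<^bsub>T\<^esub>"
        using m(1) z(1) h.S.nat_pow_Suc2[OF z(1), of "m - 1"] by simp
      then have "z divides\<^bsub>T\<^esub> \<one>\<^bsub>T\<^esub>"
        using z(1) by (intro dividesI[of "z [^]\<^bsub>T\<^esub> (m - 1)"]) auto
      then show False using z h.S.divides_one by blast
    qed
    then obtain y where y: "y \<in> carrier R" "x = p \<otimes> y" by (rule dividesE)
    then show "\<exists>y\<in>carrier T. z = h p \<otimes>\<^bsub>T\<^esub> y"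
      using x(2) p(1) by (intro bexI[of _ "h y"]) auto
  qed
  then show ?thesis by (simp add: T_def)
qed

section \<open>Counting primes in a factorial domain\<close>

lemma (in comm_monoid) funpow_mult_eq_nat_pow:
  assumes "p \<in> carrier G"
  shows "((\<otimes>) p ^^ n) \<one> = p [^] n"
  using assms by (induction n) (simp_all add: m_comm)

text \<open>By uniqueness the list of \<open>n\<close> copies of \<open>p\<close> decides both
  counts. For \<open>n = 0\<close> it is empty, whence the separate value of
  \<open>small_omega\<close>.\<close>

lemma (in factorial_domain) big_Omega_small_omega_prime_power:
  assumes a: "a \<in> carrier R" "a \<noteq> \<zero>"
    and p: "p \<in> carrier R" "ring_prime p" and assoc: "a \<sim> p [^] (n::nat)"
  shows "big_Omega R a = n" "small_omega R a = (if n = 0 then 0 else 1)"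
proof -
  have p0: "p \<noteq> \<zero>" and irr: "irreducible (mult_of R) p"
    using ring_primeE[OF p] mult_of.prime_irreducible by auto
  have carr: "set (replicate n p) \<subseteq> carrier (mult_of R)" using p p0 by auto
  have "p [^] n \<noteq> \<zero>" using p(1) p0 by (induction n) (auto simp: integral_iff)
  then have "p [^] n \<sim>\<^bsub>mult_of R\<^esub> a"
    using assoc_iff_assoc_mult[of "p [^] n" a] associated_sym[OF assoc] p(1) a(1) by blast
  then have fac: "wfactors (mult_of R) (replicate n p) a"
    using irr by (simp add: wfactors_def funpow_mult_eq_nat_pow[OF p(1)])
  show "big_Omega R a = n"
    using factorcount_unique[OF fac _ carr] a by (simp add: big_Omega_def)
  show "small_omega R a = (if n = 0 then 0 else 1)"
    unfolding small_omega_eq[OF a carr fac] by simp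
qed

text \<open>A factorization of \<open>a\<close> into irreducibles, which are prime here, is split
  into \<open>gs\<close> and the radical \<open>r\<close>. For the last property, each prime factor
  of \<open>a\<close> divides \<open>x [^] n\<close>, hence \<open>x\<close>, and \<open>r\<close>
  divides every common multiple of these primes.\<close>

lemma (in factorial_domain) radical_decomposition:
  assumes a: "a \<in> carrier R" "a \<noteq> \<zero>"
  obtains gs r where "set gs \<subseteq> carrier R" "\<forall>q\<in>set gs. ring_prime q"
    "r \<in> carrier R" "\<forall>q\<in>set gs. q divides r"
    "foldr (\<otimes>) gs \<one> \<otimes> r \<sim> a" "length gs + small_omega R a = big_Omega R a"
    "\<forall>x\<in>carrier R. \<forall>n::nat. a divides x [^] n \<longrightarrow> r divides x"
proof -
  obtain fs where carr: "set fs \<subseteq> carrier (mult_of R)" and fac: "wfactors (mult_of R) fs a"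
    using wfactors_exist[of a] a by auto
  have fs: "set fs \<subseteq> carrier R" using carr by auto
  have prime: "ring_prime q" if q: "q \<in> set fs" for q
  proof -
    have "q \<in> carrier (mult_of R)" "irreducible (mult_of R) q"
      using carr fac q by (auto simp: wfactors_def)
    then show ?thesis using irreducible_prime ring_primeI'[of q] by auto
  qed
  obtain gs r where gs: "set gs \<subseteq> set fs" and r: "r \<in> carrier R"
    and len: "length gs + card (assocs (mult_of R) ` set fs) = length fs"
    and prod: "foldr (\<otimes>) fs \<one> = foldr (\<otimes>) gs \<one> \<otimes> r"
    and dvd: "\<And>q. q \<in> set fs \<Longrightarrow> q divides r"
    and rad: "\<And>x. x \<in> carrier R \<Longrightarrow> (\<And>q. q \<in> set fs \<Longrightarrow> q divides x) \<Longrightarrow> r divides x"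
    using prime_list_split_radical[OF fs prime] by metis
  have prod_gs: "foldr (\<otimes>) gs \<one> \<in> carrier R" using gs fs by (intro multlist_closed) auto
  have "foldr (\<otimes>) fs \<one> \<sim>\<^bsub>mult_of R\<^esub> a" using fac by (simp add: wfactors_def)
  then have assoc: "foldr (\<otimes>) gs \<one> \<otimes> r \<sim> a"
    using assoc_iff_assoc_mult[of "foldr (\<otimes>) gs \<one> \<otimes> r" a] prod_gs r a(1) by (simp add: prod)
  have "big_Omega R a = length fs"
    using factorcount_unique[OF fac _ carr] a by (simp add: big_Omega_def)
  then have "length gs + small_omega R a = big_Omega R a"
    using len small_omega_eq[OF a carr fac] by simp
  moreover have "r divides x" if x: "x \<in> carrier R" "a divides x [^] n" for x and n :: nat
  proof (rule rad[OF x(1)])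
    fix q assume q: "q \<in> set fs"
    have qc: "q \<in> carrier R" "ring_prime q" using q fs prime by auto
    have "q divides foldr (\<otimes>) gs \<one> \<otimes> r" using dvd[OF q] qc(1) prod_gs r by (intro divides_prod_l)
    moreover have "foldr (\<otimes>) gs \<one> \<otimes> r divides a" using assoc by (simp add: associated_def)
    ultimately have "q divides a" using qc(1) by (rule divides_trans)
    then have "q divides x [^] n" using x(2) qc(1) by (rule divides_trans)
    then show "q divides x"
    proof (induction n)
      \<comment> \<open>The exponent 0 is vacuous, since a prime does not divide
        \<open>\<one>\<close>.\<close>
      case 0
      then show ?case using divides_one[OF qc(1)] ring_primeE(3)[OF qc] by (simp add: prime_def)
    next
      case (Suc n)
      then show ?case using ring_primeE(3)[OF qc] x(1) by (auto simp: prime_def)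
    qed
  qed
  ultimately show ?thesis using that[of gs r] gs fs prime r dvd assoc by blast
qed

section \<open>Combination of the bounds, by cases on \<open>a\<close>\<close>

theorem theorem5p2:
  fixes R :: "('a, 'b) ring_scheme" and a :: 'a
  assumes "factorial_domain R"
    and "a \<in> carrier R"
    and "finite (carrier (R Quot (PIdl\<^bsub>R\<^esub> a)))"
  shows "int (idempotent_constant (R Quot (PIdl\<^bsub>R\<^esub> a)))
           \<ge> int (davenport_constant (units_of (R Quot (PIdl\<^bsub>R\<^esub> a)))) + int (big_Omega R a) - int (small_omega R a)
       \<and> (is_prime_power R a \<longrightarrow>
           int (idempotent_constant (R Quot (PIdl\<^bsub>R\<^esub> a)))
             = int (davenport_constant (units_of (R Quot (PIdl\<^bsub>R\<^esub> a)))) + int (big_Omega R a) - int (small_omega R a))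
       \<and> (principal_domain R \<and> prime_squarefree R a \<longrightarrow>
           int (idempotent_constant (R Quot (PIdl\<^bsub>R\<^esub> a)))
             = int (davenport_constant (units_of (R Quot (PIdl\<^bsub>R\<^esub> a)))) + int (big_Omega R a) - int (small_omega R a))"
proof -
  interpret factorial_domain R by fact
  note a = assms(2) and fin = assms(3)
  let ?D = "davenport_constant (units_of (R Quot (PIdl\<^bsub>R\<^esub> a)))"
    and ?I = "idempotent_constant (R Quot (PIdl\<^bsub>R\<^esub> a))"
  interpret T: cring "R Quot (PIdl\<^bsub>R\<^esub> a)"
    by (rule ideal.quotient_is_cring[OF cgenideal_ideal[OF a] is_cring])
  show ?thesis
  proof (cases "a = \<zero>\<^bsub>R\<^esub>")
    case True
    \<comment> \<open>For \<open>a = \<zero>\<close> both prime counts are 0 by convention, so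
      nothing is appended and the claims reduce to \<open>?I = ?D\<close>. The upper bound holds as
      a domain is reduced.\<close>
    have "?D + card ({} :: nat set) \<le> ?I"
      by (rule T.davenport_constant_le_idempotent_constant[OF fin, where g = "\<lambda>_. undefined"]) auto
    moreover have "?I \<le> ?D"
      by (rule idempotent_constant_quotient_le_reduced[OF a fin])
        (auto simp: True zero_divides integral_iff)
    ultimately show ?thesis by (simp add: True big_Omega_def small_omega_def)
  next
    case a0: False
    obtain gs r where gs: "set gs \<subseteq> carrier R" "\<forall>q\<in>set gs. ring_prime\<^bsub>R\<^esub> q"
      and r: "r \<in> carrier R" "\<forall>q\<in>set gs. q divides\<^bsub>R\<^esub> r"
      and assoc: "foldr (\<otimes>\<^bsub>R\<^esub>) gs \<one>\<^bsub>R\<^esub> \<otimes>\<^bsub>R\<^esub> r \<sim>\<^bsub>R\<^esub> a"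
      and len: "length gs + small_omega R a = big_Omega R a"
      and rad: "\<forall>x\<in>carrier R. \<forall>n::nat. a divides\<^bsub>R\<^esub> x [^]\<^bsub>R\<^esub> n \<longrightarrow> r divides\<^bsub>R\<^esub> x"
      by (rule radical_decomposition[OF a a0])
    have lower: "?D + length gs \<le> ?I"
      by (rule davenport_add_length_le_idempotent_constant[OF a a0 fin gs(1) _ r(1) _ assoc])
        (use gs(2) r(2) in blast)+
    moreover have "?I \<le> ?D + length gs" if pp: "is_prime_power R a"
    proof -
      obtain p n where p: "p \<in> carrier R" "ring_prime\<^bsub>R\<^esub> p" and pn: "a \<sim>\<^bsub>R\<^esub> p [^]\<^bsub>R\<^esub> (n::nat)"
        using pp by (auto simp: is_prime_power_def)
      note Omega = big_Omega_small_omega_prime_power[OF a a0 p pn]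
      show ?thesis
      proof (cases "n = 0")
        \<comment> \<open>With exponent 0 the element \<open>a\<close> is a unit and divides
          everything, so the bound for reduced quotients applies.\<close>
        case True
        then have "a divides\<^bsub>R\<^esub> \<one>\<^bsub>R\<^esub>" using pn by (simp add: associated_def)
        then have "a divides\<^bsub>R\<^esub> x" if "x \<in> carrier R" for x
          using divides_trans[OF _ one_divides a] that by blast
        then show ?thesis
          using idempotent_constant_quotient_le_reduced[OF a fin] by force
      next
        case False
        then have "?I \<le> ?D + n - 1"
          by (intro idempotent_constant_quotient_le_prime_power[OF a fin p pn]) simp
        \<comment> \<open>Here \<open>big_Omega R a = n\<close> and
          \<open>small_omega R a = 1\<close>, so \<open>length gs = n - 1\<close>.\<close>
        then show ?thesis using False len Omega by simp
      qed
    qed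
    moreover have "?I \<le> ?D + length gs" if sf: "prime_squarefree R a"
    proof -
      have ra: "foldr (\<otimes>\<^bsub>R\<^esub>) gs \<one>\<^bsub>R\<^esub> \<otimes>\<^bsub>R\<^esub> r divides\<^bsub>R\<^esub> a"
        and ar: "a divides\<^bsub>R\<^esub> foldr (\<otimes>\<^bsub>R\<^esub>) gs \<one>\<^bsub>R\<^esub> \<otimes>\<^bsub>R\<^esub> r"
        using assoc by (auto simp: associated_def)
      \<comment> \<open>A prime \<open>q\<close> in \<open>gs\<close> divides both the product of
        \<open>gs\<close> and \<open>r\<close>, so its square would divide \<open>a\<close>.\<close>
      have "gs = []"
      proof (rule ccontr)
        assume "gs \<noteq> []"
        then obtain q where q: "q \<in> set gs" using list.set_sel(1) by blast
        have qc: "q \<in> carrier R" using q gs(1) by auto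
        obtain x where x: "x \<in> carrier R" "foldr (\<otimes>\<^bsub>R\<^esub>) gs \<one>\<^bsub>R\<^esub> = q \<otimes>\<^bsub>R\<^esub> x"
          using multlist_dividesI[OF q gs(1)] by (rule dividesE)
        obtain y where y: "y \<in> carrier R" "r = q \<otimes>\<^bsub>R\<^esub> y" using r(2)[rule_format, OF q] by (rule dividesE)
        have "foldr (\<otimes>\<^bsub>R\<^esub>) gs \<one>\<^bsub>R\<^esub> \<otimes>\<^bsub>R\<^esub> r = (q [^]\<^bsub>R\<^esub> (2::nat)) \<otimes>\<^bsub>R\<^esub> (x \<otimes>\<^bsub>R\<^esub> y)"
          unfolding x(2) y(2) using qc x(1) y(1) by (simp add: numeral_2_eq_2 m_ac)
        then have "q [^]\<^bsub>R\<^esub> (2::nat) divides\<^bsub>R\<^esub> foldr (\<otimes>\<^bsub>R\<^esub>) gs \<one>\<^bsub>R\<^esub> \<otimes>\<^bsub>R\<^esub> r"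
          using x(1) y(1) by (intro dividesI[of "x \<otimes>\<^bsub>R\<^esub> y"]) auto
        then have "q [^]\<^bsub>R\<^esub> (2::nat) divides\<^bsub>R\<^esub> a"
          using ra by (rule divides_trans) (use qc in simp)
        then show False using sf qc gs(2) q by (simp add: prime_squarefree_def)
      qed
      then have ar': "a divides\<^bsub>R\<^esub> r" using ar r(1) by simp
      have "?I \<le> ?D"
      \<comment> \<open>With \<open>gs\<close> empty, \<open>a\<close> divides its radical
        \<open>r\<close>, and the radical property at exponent 2 gives reducedness.\<close>
      proof (rule idempotent_constant_quotient_le_reduced[OF a fin])
        fix x assume x: "x \<in> carrier R" "a divides\<^bsub>R\<^esub> x \<otimes>\<^bsub>R\<^esub> x"
        have "x \<otimes>\<^bsub>R\<^esub> x = x [^]\<^bsub>R\<^esub> (2::nat)" using x(1) by (simp add: numeral_2_eq_2)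
        then have "r divides\<^bsub>R\<^esub> x" using x(2) rad x(1) by metis
        with ar' show "a divides\<^bsub>R\<^esub> x" by (rule divides_trans[OF _ _ a])
      qed
      then show ?thesis by simp
    qed
    ultimately show ?thesis using len by force
  qed
qed

end
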